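(* Let $T$ be a unital truss. If the set of units $\mathrm{U}(T)$ is a sub-heap of $T$, then $\mathrm{U}(T)$ is a (two-sided) brace, with the multiplication of $T$ and the addition $x+y=[x,1,y]$.
   Context: A heap is a set $H$ with a ternary operation $[-,-,-]$ such that $[[a,b,c],d,e]=[a,b,[c,d,e]]$ and $[b,b,a]=a=[a,b,b]$; it is abelian if $[a,b,c]=[c,b,a]$. A sub-heap is a subset closed under the ternary operation. A truss is an abelian heap $T$ with an associative binary multiplication such that $a[b,c,d]=[ab,ac,ad]$ and $[b,c,d]a=[ba,ca,da]$; it is unital if it has a multiplicative identity $1$, and then $\mathrm{U}(T)$ is the set of multiplicatively invertible elements. A two-sided brace is a set $B$ with two group operations, $+$ (commutative) and $\cdot$, such that $a(b+c)=ab-a+ac$ and $(b+c)a=ba-a+ca$ for all $a,b,c\in B$. *)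

theory Defs
  imports "HOL-Algebra.Ring"
begin

locale heap =
  fixes H :: "'a set" and br :: "'a \<Rightarrow> 'a \<Rightarrow> 'a \<Rightarrow> 'a"
  assumes br_closed: "\<lbrakk>a \<in> H; b \<in> H; c \<in> H\<rbrakk> \<Longrightarrow> br a b c \<in> H"
    and br_assoc: "\<lbrakk>a \<in> H; b \<in> H; c \<in> H; d \<in> H; e \<in> H\<rbrakk>
      \<Longrightarrow> br (br a b c) d e = br a b (br c d e)"
    and br_cancel_left: "\<lbrakk>a \<in> H; b \<in> H\<rbrakk> \<Longrightarrow> br b b a = a"
    and br_cancel_right: "\<lbrakk>a \<in> H; b \<in> H\<rbrakk> \<Longrightarrow> br a b b = a"

locale abelian_heap = heap +
  assumes br_commute: "\<lbrakk>a \<in> H; b \<in> H; c \<in> H\<rbrakk> \<Longrightarrow> br a b c = br c b a"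

definition sub_heap :: "'a set \<Rightarrow> 'a set \<Rightarrow> ('a \<Rightarrow> 'a \<Rightarrow> 'a \<Rightarrow> 'a) \<Rightarrow> bool"
  where "sub_heap S H br \<longleftrightarrow> S \<subseteq> H \<and> (\<forall>a\<in>S. \<forall>b\<in>S. \<forall>c\<in>S. br a b c \<in> S)"

(* Extending the monoid record makes "Units" available for trusses. The field "one" is
   unconstrained in the locale truss and is the identity only in unital_truss. *)
record 'a truss = "'a monoid" +
  tern :: "'a \<Rightarrow> 'a \<Rightarrow> 'a \<Rightarrow> 'a"

locale truss = abelian_heap "carrier T" "tern T" for T (structure) +
  assumes mult_closed: "\<lbrakk>a \<in> carrier T; b \<in> carrier T\<rbrakk> \<Longrightarrow> a \<otimes> b \<in> carrier T"
    and mult_assoc: "\<lbrakk>a \<in> carrier T; b \<in> carrier T; c \<in> carrier T\<rbrakk>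
      \<Longrightarrow> (a \<otimes> b) \<otimes> c = a \<otimes> (b \<otimes> c)"
    and distrib_left:
      "\<lbrakk>a \<in> carrier T; b \<in> carrier T; c \<in> carrier T; d \<in> carrier T\<rbrakk>
      \<Longrightarrow> a \<otimes> tern T b c d = tern T (a \<otimes> b) (a \<otimes> c) (a \<otimes> d)"
    and distrib_right:
      "\<lbrakk>a \<in> carrier T; b \<in> carrier T; c \<in> carrier T; d \<in> carrier T\<rbrakk>
      \<Longrightarrow> tern T b c d \<otimes> a = tern T (b \<otimes> a) (c \<otimes> a) (d \<otimes> a)"

locale unital_truss = truss T + monoid T for T (structure)

(* The ring record only serves to bundle the two group structures with their
   neutral elements; the distributive laws are those of braces, not of rings. *)
locale two_sided_brace = abelian_group B + group B for B (structure) +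
  assumes brace_left:
      "\<lbrakk>a \<in> carrier B; b \<in> carrier B; c \<in> carrier B\<rbrakk>
      \<Longrightarrow> a \<otimes> (b \<oplus> c) = ((a \<otimes> b) \<ominus> a) \<oplus> (a \<otimes> c)"
    and brace_right:
      "\<lbrakk>a \<in> carrier B; b \<in> carrier B; c \<in> carrier B\<rbrakk>
      \<Longrightarrow> (b \<oplus> c) \<otimes> a = ((b \<otimes> a) \<ominus> a) \<oplus> (c \<otimes> a)"

end

theory Submission imports Defs begin

text \<open>
  With \<open>x + y = [x, 1, y]\<close> the additive inverse is \<open>- a = [1, a, 1]\<close>, so cancellation in the
  heap gives \<open>x - a + y = [x, a, y]\<close>. The brace laws are then the truss distributive laws with
  the middle entry of the bracket equal to 1.
\<close>

lemma (in abelian_heap) abelian_heap_sub_heap: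
  assumes "sub_heap S H br"
  shows "abelian_heap S br"
proof -
  have sub: "x \<in> H" if "x \<in> S" for x
    using assms that by (auto simp: sub_heap_def)
  have closed: "br a b c \<in> S" if "a \<in> S" "b \<in> S" "c \<in> S" for a b c
    using assms that by (auto simp: sub_heap_def)
  show ?thesis
    by unfold_locales
      (simp_all add: sub closed br_assoc br_cancel_left br_cancel_right, intro br_commute sub)
qed

text \<open>Reassociating twice brings the copies of \<open>e\<close> together: [x, e, [e, a, e]]
  contains [x, e, e] = x, and afterwards [e, e, y] = y remains. The base point \<open>e\<close> thus
  disappears from the result.\<close>

lemma (in heap) retract_minus_add:
  assumes "x \<in> H" "a \<in> H" "y \<in> H" "e \<in> H"
  shows "br (br x e (br e a e)) e y = br x a y"
proof -
  have "br x e (br e a e) = br x a e"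
    using assms by (simp add: br_cancel_right flip: br_assoc)
  then show ?thesis
    using assms by (simp add: br_assoc br_cancel_left)
qed

text \<open>A heap with a chosen base point, which becomes the zero of a group. The multiplication
  of \<open>B\<close> is left free, so that the additive half of the brace can be treated
  separately.\<close>

locale abelian_heap_retract = abelian_heap "carrier B" br for B (structure) and br +
  assumes zero_closed: "\<zero> \<in> carrier B"
    and add_eq: "x \<oplus> y = br x \<zero> y"
begin

lemma retract_abelian_group: "abelian_group B"
proof (rule abelian_groupI)
  fix x assume x: "x \<in> carrier B"
  \<comment> \<open>[[0, x, 0], 0, x] = [0, x, [0, 0, x]] = [0, x, x] = 0.\<close>
  have "br \<zero> x \<zero> \<oplus> x = \<zero>"
    using x zero_closed by (simp add: add_eq br_assoc br_cancel_left br_cancel_right)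
  then show "\<exists>y\<in>carrier B. y \<oplus> x = \<zero>"
    using x zero_closed br_closed by blast
next
  fix x y assume "x \<in> carrier B" "y \<in> carrier B"
  then show "x \<oplus> y = y \<oplus> x"
    unfolding add_eq by (intro br_commute zero_closed)
qed (simp_all add: add_eq zero_closed br_closed br_assoc br_cancel_left)

lemma retract_a_inv:
  assumes "a \<in> carrier B"
  shows "\<ominus> a = br \<zero> a \<zero>"
proof -
  interpret abelian_group B by (rule retract_abelian_group)
  have "a \<oplus> br \<zero> a \<zero> = \<zero>"
    using assms zero_closed
    by (simp add: add_eq br_cancel_left br_cancel_right flip: br_assoc)
  then show ?thesis
    using assms zero_closed by (intro minus_equality) (simp_all add: br_closed a_comm)
qed

lemma minus_add_eq:
  assumes "x \<in> carrier B" "a \<in> carrier B" "y \<in> carrier B"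
  shows "(x \<ominus> a) \<oplus> y = br x a y"
  using assms zero_closed by (simp add: a_minus_def retract_a_inv add_eq retract_minus_add)

end

theorem lemma3p16:
  fixes T :: "('a, 'b) truss_scheme"
  assumes "unital_truss T"
    and "sub_heap (Units T) (carrier T) (tern T)"
  shows "two_sided_brace
    \<lparr>carrier = Units T, mult = (\<otimes>\<^bsub>T\<^esub>), one = \<one>\<^bsub>T\<^esub>,
     zero = \<one>\<^bsub>T\<^esub>, add = (\<lambda>x y. tern T x \<one>\<^bsub>T\<^esub> y)\<rparr>"
    (is "two_sided_brace ?B")
proof -
  interpret unital_truss T by (rule assms(1))
  \<comment> \<open>The sub-heap hypothesis enters here: it makes the units an abelian heap, with
    the unit 1 as base point.\<close>
  interpret abelian_heap_retract ?B "tern T"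
    using abelian_heap_sub_heap[OF assms(2)]
    by (simp add: abelian_heap_retract_def abelian_heap_retract_axioms_def)
  have "group ?B"
  proof (rule groupI)
    fix x assume "x \<in> carrier ?B"
    then show "\<exists>y\<in>carrier ?B. y \<otimes>\<^bsub>?B\<^esub> x = \<one>\<^bsub>?B\<^esub>"
      by (auto intro: bexI[of _ "inv\<^bsub>T\<^esub> x"])
  qed (auto simp: m_assoc Units_closed)
  then show ?thesis
  proof (intro two_sided_brace.intro retract_abelian_group two_sided_brace_axioms.intro)
    fix a b c assume "a \<in> carrier ?B" "b \<in> carrier ?B" "c \<in> carrier ?B"
    then have abc: "a \<in> Units T" "b \<in> Units T" "c \<in> Units T" by simp_all
    \<comment> \<open>\<open>minus_add_eq\<close> turns the right-hand side into [ab, a, ac].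
      Distributing on the left-hand side gives [ab, a1, ac], so the subtracted \<open>a\<close> is
      the product a1. The other law is the mirror image.\<close>
    show "a \<otimes>\<^bsub>?B\<^esub> (b \<oplus>\<^bsub>?B\<^esub> c) = (a \<otimes>\<^bsub>?B\<^esub> b \<ominus>\<^bsub>?B\<^esub> a) \<oplus>\<^bsub>?B\<^esub> a \<otimes>\<^bsub>?B\<^esub> c"
      using abc by (subst minus_add_eq) (simp_all add: distrib_left Units_closed)
    show "(b \<oplus>\<^bsub>?B\<^esub> c) \<otimes>\<^bsub>?B\<^esub> a = (b \<otimes>\<^bsub>?B\<^esub> a \<ominus>\<^bsub>?B\<^esub> a) \<oplus>\<^bsub>?B\<^esub> c \<otimes>\<^bsub>?B\<^esub> a"
      using abc by (subst minus_add_eq) (simp_all add: distrib_right Units_closed)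
  qed
qed

end
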